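(* Let $d \geq 1$ be an integer and let $Q$ be a convex polytope in $\mathbb{R}^d$ containing the Euclidean unit ball $\mathbf{B}^d$. Then there are at most $2d$ vertices of $Q$ whose convex hull $Q'$ satisfies \[ \frac{1}{5d^2}\, \mathbf{B}^d \subset Q'. \]
   Context: $\mathbf{B}^d = \{x \in \mathbb{R}^d : |x| \leq 1\}$ denotes the standard closed Euclidean unit ball centered at the origin of $\mathbb{R}^d$, and for $r>0$, $r\mathbf{B}^d = \{r x : x \in \mathbf{B}^d\}$. A convex polytope is the convex hull of a finite set of points (in particular it is bounded); its vertices are its extreme points. *)

theory Defs
  imports "HOL-Analysis.Analysis"
begin

end

theory Submission
  imports Defs
begin

text \<open>
  Consider first a polytope \<open>conv W\<close> in dimension \<open>d\<close> which contains a ball of radius \<open>r\<close> about the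
  origin and is not too asymmetric: \<open>- w / d\<close> lies in it for every \<open>w \<in> W\<close>. Let \<open>f 1, \<dots>, f d\<close> be the
  points of \<open>W\<close> that maximise \<open>\<bar>det\<bar>\<close>. By Cramer's rule all of \<open>conv W\<close>, hence the ball, lies in the
  parallelotope of the \<open>\<Sum> l i *\<^sub>R f i\<close> with \<open>\<bar>l i\<bar> \<le> 1\<close>. The centroid \<open>c\<close> of the \<open>f i\<close> is a point of
  \<open>conv W\<close>, so by the asymmetry bound the ray from \<open>0\<close> through \<open>- c\<close> stays in \<open>conv W\<close> at least up to
  \<open>- c / d\<close>. Where it leaves, it meets a proper face, and Caratheodory's theorem in that face
  spends at most \<open>d\<close> further points of \<open>W\<close>. The \<open>2 d\<close> points so chosen have a hull containing the
  ball of radius \<open>r / (d (d + 2))\<close>: a functional \<open>x\<close> that is at most \<open>1\<close> on all of them is at most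
  \<open>1\<close> on every \<open>f i\<close> and at least \<open>- d\<close> on \<open>c\<close>, and these bounds control it on the whole
  parallelotope. This is lemma \<open>steinitz_bounded_asymmetry\<close>.

  A general polytope \<open>Q = conv V\<close> may be very asymmetric, and this is repaired on the dual side. The
  polar \<open>P\<close> of \<open>Q\<close> lies in the unit ball, and by Helly's theorem
  (\<open>exists_centre_asymmetry_le_dim\<close>) it contains a point \<open>z\<close> such that \<open>z + (z - x) / d \<in> P\<close> for all
  \<open>x \<in> P\<close>. The half-spaces \<open>v \<bullet> x \<le> 1\<close> that cut out \<open>P\<close> become, after the translation of \<open>z\<close> to
  the origin, the half-spaces \<open>w v \<bullet> x \<le> 1\<close> with \<open>w v = v / (1 - v \<bullet> z)\<close>. So the points \<open>w v\<close> are
  as the first step demands, with \<open>r = (d + 1) / (2 d + 1)\<close>, because \<open>norm z \<le> d / (d + 1)\<close>. The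
  first step bounds an intersection of \<open>2 d\<close> of the translated half-spaces; undoing the
  translation costs another \<open>norm z\<close>, and
  \<open>d (d + 2) (2 d + 1) / (d + 1) + d / (d + 1) \<le> 5 d\<^sup>2\<close>, with equality for \<open>d = 1\<close>. Polarity
  (\<open>convex_hull_bipolar\<close>) turns this bound into the ball inside the hull of the \<open>2 d\<close> vertices.
\<close>

section \<open>Convex hulls and polarity\<close>

lemma inner_le_convex_hull:
  fixes x :: "'a::real_inner"
  assumes "\<And>w. w \<in> W \<Longrightarrow> x \<bullet> w \<le> b" and "q \<in> convex hull W"
  shows "x \<bullet> q \<le> b"
proof -
  have "convex hull W \<subseteq> {w. x \<bullet> w \<le> b}"
    by (rule hull_minimal) (use assms(1) in \<open>auto simp: convex_halfspace_le\<close>)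
  then show ?thesis using assms(2) by auto
qed

text \<open>
  The bipolar theorem for a finite set: a hyperplane that separates \<open>q\<close> strictly from the hull
  does not pass through \<open>0\<close>, so it can be normalised to the form \<open>x \<bullet> u = 1\<close>.
\<close>
lemma convex_hull_bipolar:
  fixes W :: "'a::euclidean_space set"
  assumes "finite W" and zero: "0 \<in> convex hull W"
    and q: "\<And>x. (\<And>w. w \<in> W \<Longrightarrow> x \<bullet> w \<le> 1) \<Longrightarrow> x \<bullet> q \<le> 1"
  shows "q \<in> convex hull W"
proof (rule ccontr)
  assume "q \<notin> convex hull W"
  moreover have "closed (convex hull W)"
    using assms(1) by (simp add: finite_imp_compact_convex_hull compact_imp_closed)
  ultimately obtain a b where ab: "a \<bullet> q < b" "\<And>x. x \<in> convex hull W \<Longrightarrow> a \<bullet> x > b"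
    using separating_hyperplane_closed_point[OF convex_convex_hull] by blast
  have "b < 0" using ab(2)[OF zero] by simp
  have "(a /\<^sub>R b) \<bullet> q \<le> 1"
  proof (rule q)
    fix w assume "w \<in> W"
    then have "a \<bullet> w > b" using ab(2) hull_inc by metis
    then show "(a /\<^sub>R b) \<bullet> w \<le> 1" using \<open>b < 0\<close> by (simp add: field_simps)
  qed
  then show False using ab(1) \<open>b < 0\<close> by (simp add: field_simps)
qed

text \<open>The converse direction of polarity: a large hull has a small polar.\<close>
lemma norm_le_if_cball_subset_hull:
  fixes W :: "'a::real_inner set"
  assumes "cball 0 r \<subseteq> convex hull W" "0 \<le> r" and x: "\<And>w. w \<in> W \<Longrightarrow> x \<bullet> w \<le> 1"
  shows "r * norm x \<le> 1"
proof (cases "x = 0")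
  case False
  have "(r / norm x) *\<^sub>R x \<in> cball 0 r" using False \<open>0 \<le> r\<close> by simp
  then have "x \<bullet> ((r / norm x) *\<^sub>R x) \<le> 1"
    using assms(1) by (intro inner_le_convex_hull[OF x]) auto
  then show ?thesis using False by (simp add: dot_square_norm power2_eq_square)
qed simp

text \<open>
  A translation of the polar multiplies each vertex by its own positive factor. A convex
  combination of the points that vanishes is turned into one of the rescaled points by dividing
  the coefficients by these factors and normalising their sum.
\<close>
lemma zero_in_convex_hull_rescale:
  fixes f :: "'b \<Rightarrow> 'a::real_vector"
  assumes "finite S" "0 \<in> convex hull (f ` S)" and g: "\<And>v. v \<in> S \<Longrightarrow> 0 < g v"
  shows "0 \<in> convex hull ((\<lambda>v. g v *\<^sub>R f v) ` S)"
proof -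
  \<comment> \<open>One representative for each point, so that coefficients of points become coefficients of indices.\<close>
  obtain R where R: "R \<subseteq> S" "inj_on f R" "f ` S = f ` R"
    using subset_image_inj[of "f ` S" f S] by auto
  have finR: "finite R" using R(1) assms(1) finite_subset by blast
  obtain c where c: "\<And>u. u \<in> f ` R \<Longrightarrow> 0 \<le> c u" "sum c (f ` R) = 1" "(\<Sum>u\<in>f ` R. c u *\<^sub>R u) = 0"
    using assms(2) unfolding R(3) convex_hull_finite[OF finite_imageI[OF finR]] by auto
  define k where "k v = c (f v) / g v" for v
  have gR: "0 < g v" if "v \<in> R" for v using g R(1) that by blast
  have nn: "0 \<le> k v" if "v \<in> R" for v
    using c(1) gR that by (simp add: k_def less_imp_le)
  have c_k: "c (f v) = k v * g v" if "v \<in> R" for v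
    using gR[OF that] by (simp add: k_def)
  have sums: "(\<Sum>v\<in>R. k v * g v) = 1" "(\<Sum>v\<in>R. k v *\<^sub>R (g v *\<^sub>R f v)) = 0"
    using c(2,3) by (simp_all add: sum.reindex[OF R(2)] c_k)
  define N where "N = sum k R"
  have "N \<noteq> 0"
  proof
    assume "N = 0"
    then have "\<forall>v\<in>R. k v = 0"
      unfolding N_def using nn finR by (simp add: sum_nonneg_eq_0_iff)
    then show False using sums(1) by simp
  qed
  then have "N > 0" using nn sum_nonneg[of R k] unfolding N_def by force
  have "(\<Sum>v\<in>R. (k v / N) *\<^sub>R (g v *\<^sub>R f v)) \<in> convex hull ((\<lambda>v. g v *\<^sub>R f v) ` S)"
  proof (rule convex_sum)
    show "(\<Sum>v\<in>R. k v / N) = 1"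
      using \<open>N > 0\<close> unfolding sum_divide_distrib[symmetric] N_def by simp
  qed (use finR R(1) nn \<open>N > 0\<close> in \<open>auto simp: hull_inc\<close>)
  also have "(\<Sum>v\<in>R. (k v / N) *\<^sub>R (g v *\<^sub>R f v)) = (1 / N) *\<^sub>R (\<Sum>v\<in>R. k v *\<^sub>R (g v *\<^sub>R f v))"
    by (simp add: scaleR_sum_right)
  finally show ?thesis using sums(2) by simp
qed

section \<open>A centre of bounded asymmetry\<close>

text \<open>
  The Minkowski--Radon bound on asymmetry. For at most \<open>d + 1\<close> points of \<open>P\<close> the condition on \<open>z\<close>
  is met by their centroid, where one of them is repeated if there are fewer: the point opposite
  to \<open>x\<close> is then the average of the remaining \<open>d\<close>. The sets of admissible \<open>z\<close> are convex and
  compact, so Helly's theorem settles finitely many points, and compactness settles all of them.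
\<close>
lemma exists_centre_asymmetry_le_dim:
  fixes P :: "'a::euclidean_space set"
  assumes "compact P" "convex P" "P \<noteq> {}"
  obtains z where "z \<in> P" "\<And>x. x \<in> P \<Longrightarrow> z + (z - x) /\<^sub>R DIM('a) \<in> P"
proof -
  let ?d = "real DIM('a)"
  have d: "?d > 0" by simp
  define S where "S x = {z \<in> P. z + (z - x) /\<^sub>R ?d \<in> P}" for x
  have S_vimage: "S x = P \<inter> (\<lambda>z. z + (z - x) /\<^sub>R ?d) -` P" for x
    unfolding S_def by auto
  have closed_S: "closed (S x)" for x
    unfolding S_vimage using compact_imp_closed[OF assms(1)]
    by (intro closed_Int closed_vimage) (auto intro!: continuous_intros)
  have convex_S: "convex (S x)" for x
  proof -
    have "z + (z - x) /\<^sub>R ?d = (1 + 1 / ?d) *\<^sub>R z - x /\<^sub>R ?d" for z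
      by (simp add: algebra_simps inverse_eq_divide)
    then have "(\<lambda>z. z + (z - x) /\<^sub>R ?d) -` P = (*\<^sub>R) (1 + 1 / ?d) -` ((+) (x /\<^sub>R ?d) ` P)"
      by (force simp: image_iff)
    then have "convex ((\<lambda>z. z + (z - x) /\<^sub>R ?d) -` P)"
      using convex_linear_vimage[OF linear_scaleR convex_translation[OF assms(2)]] by simp
    then show ?thesis unfolding S_vimage by (intro convex_Int assms(2))
  qed
  have few: "\<exists>z. \<forall>x\<in>F. z \<in> S x" if F: "F \<subseteq> P" "finite F" "F \<noteq> {}" "card F \<le> DIM('a) + 1" for F
  proof -
    obtain x0 where "x0 \<in> F" using F by blast
    \<comment> \<open>The point \<open>x0\<close> is counted \<open>m\<close> additional times, to make \<open>d + 1\<close> points in all.\<close>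
    define m where "m = ?d + 1 - card F"
    have m: "m \<ge> 0" using F(4) unfolding m_def by linarith
    define s where "s = (\<Sum>u\<in>F. (1 + (if u = x0 then m else 0)) *\<^sub>R u)"
    have y: "(s - x) /\<^sub>R ?d \<in> P" if "x \<in> F" for x
    proof -
      have "(\<Sum>u\<in>F. (((if u = x then 0 else 1) + (if u = x0 then m else 0)) / ?d) *\<^sub>R u) \<in> P"
      proof (rule convex_sum)
        have "(\<Sum>u\<in>F. (if u = x then 0 else 1::real)) = (\<Sum>u\<in>F. 1 - (if u = x then 1 else 0))"
          by (rule sum.cong) auto
        also have "\<dots> = real (card F) - 1"
          using \<open>x \<in> F\<close> F(2) by (simp add: sum_subtractf)
        finally show "(\<Sum>u\<in>F. ((if u = x then 0 else 1) + (if u = x0 then m else 0)) / ?d) = 1"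
          using \<open>x0 \<in> F\<close> F(2) d
          by (simp add: sum_divide_distrib[symmetric] sum.distrib m_def)
      qed (use F assms(2) m in auto)
      also have "(\<Sum>u\<in>F. (((if u = x then 0 else 1) + (if u = x0 then m else 0)) / ?d) *\<^sub>R u)
          = (\<Sum>u\<in>F. ((1 + (if u = x0 then m else 0)) *\<^sub>R u - (if u = x then u else 0)) /\<^sub>R ?d)"
        by (rule sum.cong) (auto simp: algebra_simps inverse_eq_divide add_divide_distrib)
      also have "\<dots> = (s - x) /\<^sub>R ?d"
        unfolding s_def using \<open>x \<in> F\<close> F(2)
        by (simp add: scaleR_sum_right[symmetric] sum_subtractf)
      finally show ?thesis .
    qed
    define z where "z = s /\<^sub>R (?d + 1)"
    have "z \<in> S x" if "x \<in> F" for x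
    proof -
      have e: "z + (z - x) /\<^sub>R ?d = (s - x) /\<^sub>R ?d"
      proof -
        have "z + (z - x) /\<^sub>R ?d = ((?d + 1) *\<^sub>R z - x) /\<^sub>R ?d"
          using d by (simp add: algebra_simps)
        moreover have "(?d + 1) *\<^sub>R z = s" unfolding z_def by simp
        ultimately show ?thesis by simp
      qed
      have "z = (?d / (?d + 1)) *\<^sub>R ((s - x) /\<^sub>R ?d) + (1 / (?d + 1)) *\<^sub>R x"
        unfolding z_def using d by (simp add: algebra_simps divide_simps)
      also have "\<dots> \<in> P"
        using y[OF that] that F(1) d by (intro convexD[OF assms(2)]) (auto simp: field_simps)
      finally show ?thesis unfolding S_def using y[OF that] e by simp
    qed
    then show ?thesis by blast
  qed
  have fin: "P \<inter> \<Inter> (S ` F) \<noteq> {}" if F: "F \<subseteq> P" "finite F" for F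
  proof (cases "F = {}")
    case False
    \<comment> \<open>Helly's theorem counts sets, and different points may give the same set.\<close>
    have sub: "\<Inter> t \<noteq> {}" if t: "t \<subseteq> S ` F" "card t \<le> DIM('a) + 1" for t
    proof (cases "t = {}")
      case False
      obtain G where G: "G \<subseteq> F" "inj_on S G" "t = S ` G"
        using t(1) by (auto simp: subset_image_inj)
      have "card G = card t" using G by (simp add: card_image)
      then have "\<exists>z. \<forall>x\<in>G. z \<in> S x"
        using F False t(2) G by (intro few) (auto intro: finite_subset)
      then show ?thesis using G(3) by auto
    qed simp
    have "\<Inter> (S ` F) \<noteq> {}"
    proof (cases "card (S ` F) \<ge> DIM('a) + 1")
      case True
      then show ?thesis
      proof (rule Helly)
        show "\<forall>C\<in>S ` F. convex C" using convex_S by simp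
        show "\<Inter> t \<noteq> {}" if "t \<subseteq> S ` F" "card t = DIM('a) + 1" for t
          using that by (intro sub) simp_all
      qed
    next
      case False
      then show ?thesis by (intro sub) auto
    qed
    moreover have "\<Inter> (S ` F) \<subseteq> P" using False unfolding S_def by auto
    ultimately show ?thesis by blast
  qed (use assms(3) in simp)
  have "P \<inter> (\<Inter>x\<in>P. S x) \<noteq> {}"
    by (rule compact_imp_fip_image) (use assms(1) closed_S fin in auto)
  then obtain z where "z \<in> P" "\<And>x. x \<in> P \<Longrightarrow> z \<in> S x" by blast
  then show ?thesis by (intro that[of z]) (auto simp: S_def)
qed

section \<open>Caratheodory's theorem on the frontier\<close>

text \<open>
  One point fewer than in Caratheodory's theorem suffices, because a frontier point lies in the
  hull of those points of \<open>S\<close> that lie on a supporting hyperplane, which has dimension \<open>d - 1\<close>.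
\<close>
lemma caratheodory_frontier:
  fixes S :: "'a::euclidean_space set"
  assumes "finite S" "y \<in> frontier (convex hull S)"
  obtains T where "T \<subseteq> S" "card T \<le> DIM('a)" "y \<in> convex hull T"
proof -
  let ?C = "convex hull S"
  have cl: "closed ?C" using assms(1) by (simp add: finite_imp_compact_convex_hull compact_imp_closed)
  have y: "y \<in> ?C" "y \<notin> interior ?C"
    using assms(2) cl unfolding frontier_def by auto
  obtain a where a: "a \<noteq> 0" "\<And>u. u \<in> ?C \<Longrightarrow> a \<bullet> y \<le> a \<bullet> u"
  proof (cases "interior ?C = {}")
    \<comment> \<open>A hull with empty interior lies in a hyperplane, which then serves as supporting hyperplane.\<close>
    case True
    then obtain a b where "a \<noteq> 0" "?C \<subseteq> {x. a \<bullet> x = b}"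
      using empty_interior_subset_hyperplane[OF convex_convex_hull] by blast
    then have "\<And>u. u \<in> ?C \<Longrightarrow> a \<bullet> y = a \<bullet> u" using y(1) by blast
    then show ?thesis using \<open>a \<noteq> 0\<close> by (intro that[of a]) simp_all
  next
    case False
    then have "y \<notin> rel_interior ?C" using y(2) by (simp add: rel_interior_nonempty_interior)
    then show ?thesis
      using supporting_hyperplane_rel_boundary[OF convex_convex_hull y(1)] that by metis
  qed
  let ?F = "?C \<inter> {x. a \<bullet> x = a \<bullet> y}"
  have "?F face_of ?C"
    by (rule face_of_Int_supporting_hyperplane_ge) (use a(2) in auto)
  then obtain S' where S': "S' \<subseteq> S" "?F = convex hull S'"
    using face_of_convex_hull_subset[OF finite_imp_compact[OF assms(1)]] by blast
  have "y \<in> convex hull S'" using y(1) S'(2) by blast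
  then obtain T where T: "finite T" "T \<subseteq> S'" "card T \<le> aff_dim S' + 1" "y \<in> convex hull T"
    unfolding caratheodory_aff_dim[of S'] by blast
  have "S' \<subseteq> {x. a \<bullet> x = a \<bullet> y}" using S'(2) hull_subset[of S' convex] by auto
  then have "aff_dim S' \<le> aff_dim {x. a \<bullet> x = a \<bullet> y}" by (rule aff_dim_subset)
  then have "aff_dim S' \<le> int DIM('a) - 1" using a(1) by simp
  then show ?thesis using T S'(1) by (intro that[of T]) auto
qed

section \<open>A basis of maximal determinant\<close>

lemma det_ne_0_iff_inj:
  fixes A :: "real^'n^'n"
  shows "det A \<noteq> 0 \<longleftrightarrow> inj ((*v) A)"
  using det_nz_iff_inj[OF matrix_vector_mul_linear[of A]] by (simp add: matrix_of_matrix_vector_mul)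

text \<open>
  Choose \<open>f\<close> with values in \<open>W\<close> so that \<open>\<bar>det\<bar>\<close> is maximal. By Cramer's rule each coordinate of
  \<open>w \<in> W\<close> is the determinant with \<open>f k\<close> replaced by \<open>w\<close>, over the maximal determinant, so it is at
  most \<open>1\<close> in absolute value. Such combinations form a convex set, which therefore contains the hull.
\<close>
lemma exists_dominating_basis:
  fixes W :: "(real^'n) set"
  assumes "finite W" "span W = UNIV"
  obtains f :: "'n \<Rightarrow> real^'n" where "range f \<subseteq> W" "(\<Sum>i\<in>UNIV. f i) \<noteq> 0"
    "\<forall>q\<in>convex hull W. \<exists>l. (\<forall>i. \<bar>l i\<bar> \<le> 1) \<and> q = (\<Sum>i\<in>UNIV. l i *\<^sub>R f i)"
proof -
  define D where "D f = \<bar>det (\<chi> i j. f j $ i)\<bar>" for f :: "'n \<Rightarrow> real^'n"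
  let ?\<F> = "{f. range f \<subseteq> W} :: ('n \<Rightarrow> real^'n) set"
  have fin: "finite ?\<F>"
    using finite_set_of_finite_funs[of "UNIV :: 'n set" W] assms(1)
    by (simp add: image_subset_iff)
  obtain B where B: "B \<subseteq> W" "independent B" "span B = UNIV"
    using basis_exists[of W] assms(2) by (metis span_mono subset_UNIV subset_antisym span_span)
  have "finite B" using B(2) independent_imp_finite by blast
  have "card B = CARD('n)"
    using dim_eq_card[of B UNIV] B by (simp add: dim_UNIV)
  then obtain h :: "'n \<Rightarrow> real^'n" where h: "bij_betw h UNIV B"
    using \<open>finite B\<close> by (metis finite finite_same_card_bij)
  have mult: "(\<chi> i j. f j $ i) *v x = (\<Sum>j\<in>UNIV. x $ j *\<^sub>R f j)" for f :: "'n \<Rightarrow> real^'n" and x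
    by (simp add: matrix_vector_mult_def vec_eq_iff mult.commute)
  have "inj ((*v) (\<chi> i j. h j $ i))"
  proof -
    have "x = 0" if "(\<Sum>j\<in>UNIV. x $ j *\<^sub>R h j) = 0" for x
    proof -
      have "(\<Sum>b\<in>B. (x $ inv h b) *\<^sub>R b) = 0"
        using that h inv_f_f[OF bij_betw_imp_inj_on[OF h]]
        by (simp add: sum.reindex_bij_betw[OF h, symmetric])
      then have "\<forall>b\<in>B. x $ inv h b = 0"
        using B(2) \<open>finite B\<close> by (auto simp: independent_explicit)
      then have "x $ j = 0" for j
        using h inv_f_f[OF bij_betw_imp_inj_on[OF h]] by (metis bij_betw_apply UNIV_I)
      then show "x = 0" by (simp add: vec_eq_iff)
    qed
    then show ?thesis
      by (simp add: linear_injective_0 matrix_vector_mul_linear mult)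
  qed
  then have "D h \<noteq> 0" unfolding D_def by (simp add: det_ne_0_iff_inj)
  have hF: "h \<in> ?\<F>" using h B(1) by (auto simp: bij_betw_def)
  obtain f where f: "f \<in> ?\<F>" "\<And>g. g \<in> ?\<F> \<Longrightarrow> D g \<le> D f"
  proof -
    have "Max (D ` ?\<F>) \<in> D ` ?\<F>" using fin hF by (intro Max_in) auto
    then obtain f where "f \<in> ?\<F>" "Max (D ` ?\<F>) = D f" by blast
    moreover have "D g \<le> Max (D ` ?\<F>)" if "g \<in> ?\<F>" for g
      using fin that by (intro Max_ge) auto
    ultimately show ?thesis using that by metis
  qed
  let ?A = "(\<chi> i j. f j $ i) :: real^'n^'n"
  have "D f > 0" using f(2)[OF hF] \<open>D h \<noteq> 0\<close> unfolding D_def by linarith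
  then have det: "det ?A \<noteq> 0" unfolding D_def by simp
  have rep: "\<exists>l. (\<forall>i. \<bar>l i\<bar> \<le> 1) \<and> w = (\<Sum>i\<in>UNIV. l i *\<^sub>R f i)" if "w \<in> W" for w
  proof -
    define x where "x = (\<chi> k. det (\<chi> i j. if j = k then w $ i else ?A $ i $ j) / det ?A)"
    have "?A *v x = w" using cramer[OF det, of x w] unfolding x_def by blast
    then have "w = (\<Sum>i\<in>UNIV. x $ i *\<^sub>R f i)" using mult by metis
    moreover have "\<bar>x $ k\<bar> \<le> 1" for k
    proof -
      have "f(k := w) \<in> ?\<F>" using f(1) that by auto
      then have "D (f(k := w)) \<le> D f" by (rule f(2))
      moreover have "(\<chi> i j. if j = k then w $ i else ?A $ i $ j) = (\<chi> i j. (f(k := w)) j $ i)"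
        by (simp add: vec_eq_iff)
      ultimately show ?thesis using \<open>D f > 0\<close> unfolding x_def D_def by (simp add: abs_divide)
    qed
    ultimately show ?thesis by blast
  qed
  show ?thesis
  proof (rule that[of f])
    show "range f \<subseteq> W" using f(1) by simp
    show "(\<Sum>i\<in>UNIV. f i) \<noteq> 0"
    proof
      assume "(\<Sum>i\<in>UNIV. f i) = 0"
      then have "?A *v 1 = ?A *v 0" by (simp add: mult)
      moreover have "inj ((*v) ?A)" using det by (simp add: det_ne_0_iff_inj)
      ultimately have "(1 :: real^'n) = 0" by (rule injD[rotated])
      then show False by simp
    qed
    let ?Par = "{\<Sum>i\<in>UNIV. l i *\<^sub>R f i | l. \<forall>i. \<bar>l i\<bar> \<le> 1}"
    have "convex ?Par"
    proof (rule convexI)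
      fix p p' :: "real^'n" and s t :: real
      assume "p \<in> ?Par" "p' \<in> ?Par" and st: "0 \<le> s" "0 \<le> t" "s + t = 1"
      then obtain l l' where l: "\<forall>i. \<bar>l i\<bar> \<le> 1" "p = (\<Sum>i\<in>UNIV. l i *\<^sub>R f i)"
        and l': "\<forall>i. \<bar>l' i\<bar> \<le> 1" "p' = (\<Sum>i\<in>UNIV. l' i *\<^sub>R f i)" by blast
      have "s *\<^sub>R p + t *\<^sub>R p' = (\<Sum>i\<in>UNIV. (s * l i + t * l' i) *\<^sub>R f i)"
        unfolding l l' by (simp add: scaleR_sum_right sum.distrib scaleR_add_left)
      moreover have "\<bar>s * l i + t * l' i\<bar> \<le> 1" for i
      proof -
        have "\<bar>s * l i + t * l' i\<bar> \<le> s * \<bar>l i\<bar> + t * \<bar>l' i\<bar>"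
          using st abs_triangle_ineq[of "s * l i" "t * l' i"] by (simp add: abs_mult)
        also have "\<dots> \<le> s * 1 + t * 1" using l(1) l'(1) st by (intro add_mono mult_left_mono) auto
        finally show ?thesis using st by simp
      qed
      ultimately show "s *\<^sub>R p + t *\<^sub>R p' \<in> ?Par"
        by (intro CollectI exI[of _ "\<lambda>i. s * l i + t * l' i"]) simp
    qed
    then have "convex hull W \<subseteq> ?Par" using rep by (intro hull_minimal) blast+
    then show "\<forall>q\<in>convex hull W. \<exists>l. (\<forall>i. \<bar>l i\<bar> \<le> 1) \<and> q = (\<Sum>i\<in>UNIV. l i *\<^sub>R f i)"
      by blast
  qed
qed

section \<open>Selecting points from a polytope of bounded asymmetry\<close>

text \<open>
  The quantitative Steinitz theorem under a bound on the asymmetry. That bound keeps the exit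
  point \<open>- t *\<^sub>R c\<close> of the ray opposite to the centroid \<open>c\<close> away from \<open>0\<close>, namely \<open>t \<ge> 1 / d\<close>; without it
  the constraint which the exit point puts on a functional would be arbitrarily weak.
\<close>
lemma steinitz_bounded_asymmetry:
  fixes W :: "(real^'n) set"
  assumes "finite W" "r > 0" and ball: "cball 0 r \<subseteq> convex hull W"
    and asym: "\<And>w. w \<in> W \<Longrightarrow> - (w /\<^sub>R CARD('n)) \<in> convex hull W"
  obtains I where "I \<subseteq> W" "card I \<le> 2 * CARD('n)"
    "cball 0 (r / (real CARD('n) * (real CARD('n) + 2))) \<subseteq> convex hull I"
proof -
  let ?d = "real CARD('n)"
  have d: "?d > 0" by simp
  have int0: "0 \<in> interior (convex hull W)"
    using ball \<open>r > 0\<close> by (meson centre_in_ball interior_maximal open_ball ball_subset_cball subset_trans subsetD)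
  have "x \<in> span W" for x
  proof (cases "x = 0")
    case False
    then have "(r / norm x) *\<^sub>R x \<in> convex hull W" using ball \<open>r > 0\<close> by auto
    then have "(r / norm x) *\<^sub>R x \<in> span W" using convex_hull_subset_span by blast
    then have "(norm x / r) *\<^sub>R (r / norm x) *\<^sub>R x \<in> span W" by (rule span_scale)
    then show ?thesis using False \<open>r > 0\<close> by simp
  qed (simp add: span_zero)
  then have "span W = UNIV" by auto
  then obtain f :: "'n \<Rightarrow> real^'n" where f: "range f \<subseteq> W" "(\<Sum>i\<in>UNIV. f i) \<noteq> 0"
    and rep: "\<forall>q\<in>convex hull W. \<exists>l. (\<forall>i. \<bar>l i\<bar> \<le> 1) \<and> q = (\<Sum>i\<in>UNIV. l i *\<^sub>R f i)"
    by (rule exists_dominating_basis[OF assms(1)])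
  define c where "c = (\<Sum>i\<in>UNIV. (1 / ?d) *\<^sub>R f i)"
  have c_eq: "c = (1 / ?d) *\<^sub>R (\<Sum>i\<in>UNIV. f i)" unfolding c_def by (rule scaleR_sum_right[symmetric])
  have "c \<noteq> 0" using f(2) unfolding c_eq by simp
  have c_hull: "c \<in> convex hull (range f)"
    unfolding c_def by (rule convex_sum) (auto simp: hull_inc)
  have opp: "- (c /\<^sub>R ?d) \<in> convex hull W"
  proof -
    have "(\<Sum>i\<in>UNIV. (1 / ?d) *\<^sub>R (- (f i /\<^sub>R ?d))) \<in> convex hull W"
      by (rule convex_sum) (use asym f(1) in auto)
    also have "(\<Sum>i\<in>UNIV. (1 / ?d) *\<^sub>R (- (f i /\<^sub>R ?d))) = - (c /\<^sub>R ?d)"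
      unfolding c_def scaleR_sum_right sum_negf[symmetric] by (rule sum.cong) simp_all
    finally show ?thesis .
  qed
  have "bounded (convex hull W)" using assms(1) by (simp add: finite_imp_bounded_convex_hull)
  then obtain t where t: "0 < t" "0 + t *\<^sub>R (- c) \<in> frontier (convex hull W)"
    using ray_to_frontier[OF _ int0, of "- c"] \<open>c \<noteq> 0\<close> by auto
  \<comment> \<open>Points strictly between the interior point \<open>0\<close> and \<open>- c / d\<close> are interior, not on the frontier.\<close>
  have "t \<ge> 1 / ?d"
  proof (rule ccontr)
    assume "\<not> t \<ge> 1 / ?d"
    then have "t *\<^sub>R (- c) \<in> open_segment 0 (- (c /\<^sub>R ?d))"
      using t(1) \<open>c \<noteq> 0\<close> d unfolding in_segment
      by (auto intro!: exI[of _ "t * ?d"] simp: field_simps)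
    then have "t *\<^sub>R (- c) \<in> interior (convex hull W)"
      using in_interior_closure_convex_segment[OF convex_convex_hull int0] opp closure_subset by blast
    then show False using t(2) unfolding frontier_def by simp
  qed
  obtain T where T: "T \<subseteq> W" "card T \<le> CARD('n)" "t *\<^sub>R (- c) \<in> convex hull T"
    using caratheodory_frontier[OF assms(1) t(2)] by auto
  let ?I = "range f \<union> T"
  have cI: "c \<in> convex hull ?I" "t *\<^sub>R (- c) \<in> convex hull ?I"
    using c_hull T(3) hull_mono[of "range f" ?I convex] hull_mono[of T ?I convex] by auto
  have finI: "finite ?I" using T(1) assms(1) finite_subset by auto
  have zero: "0 \<in> convex hull ?I"
  proof -
    have "(t / (1 + t)) *\<^sub>R c + (1 / (1 + t)) *\<^sub>R (t *\<^sub>R (- c)) \<in> convex hull ?I"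
      using t(1) cI by (intro convexD[OF convex_convex_hull]) (auto simp: field_simps)
    then show ?thesis by simp
  qed
  show ?thesis
  proof (rule that[of ?I])
    show "?I \<subseteq> W" using f T by blast
    have "card ?I \<le> card (range f) + card T" by (rule card_Un_le)
    also have "card (range f) \<le> CARD('n)" by (rule card_image_le) simp
    finally show "card ?I \<le> 2 * CARD('n)" using T(2) by linarith
    show "cball 0 (r / (?d * (?d + 2))) \<subseteq> convex hull ?I"
    proof
      fix q :: "real^'n" assume q: "q \<in> cball 0 (r / (?d * (?d + 2)))"
      let ?n = "?d * (?d + 2)"
      have n: "?n > 0" by simp
      have "norm (?n *\<^sub>R q) \<le> r"
        using q n unfolding norm_scaleR by (simp add: le_divide_eq mult.commute)
      then have "?n *\<^sub>R q \<in> convex hull W" using ball by auto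
      then obtain l where l: "\<forall>i. \<bar>l i\<bar> \<le> 1" "?n *\<^sub>R q = (\<Sum>i\<in>UNIV. l i *\<^sub>R f i)"
        using rep by blast
      show "q \<in> convex hull ?I"
      proof (rule convex_hull_bipolar[OF finI zero])
        fix x assume x: "\<And>w. w \<in> ?I \<Longrightarrow> x \<bullet> w \<le> 1"
        have "x \<bullet> (t *\<^sub>R (- c)) \<le> 1" using x cI(2) by (rule inner_le_convex_hull)
        then have "- (x \<bullet> c) \<le> 1 / t" using t(1) by (simp add: field_simps)
        also have "\<dots> \<le> ?d" using \<open>t \<ge> 1 / ?d\<close> t(1) d by (simp add: field_simps)
        finally have xc: "- (x \<bullet> c) \<le> ?d" .
        have "?n * (x \<bullet> q) = x \<bullet> (?n *\<^sub>R q)" by simp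
        also have "\<dots> = (\<Sum>i\<in>UNIV. l i * (x \<bullet> f i))" unfolding l(2) by (simp add: inner_sum_right)
        also have "\<dots> \<le> (\<Sum>i\<in>UNIV. 2 - x \<bullet> f i)"
        proof (rule sum_mono)
          fix i
          have "0 \<le> (1 + l i) * (1 - x \<bullet> f i)"
            using l(1)[rule_format, of i] x[of "f i"] by (intro mult_nonneg_nonneg) auto
          then show "l i * (x \<bullet> f i) \<le> 2 - x \<bullet> f i"
            using l(1)[rule_format, of i] by (simp add: algebra_simps)
        qed
        also have "\<dots> = 2 * ?d + ?d * (- (x \<bullet> c))"
          unfolding c_eq using d by (simp add: sum_subtractf inner_sum_right)
        also have "\<dots> \<le> 2 * ?d + ?d * ?d" using xc d by (intro add_left_mono mult_left_mono) auto
        also have "\<dots> = ?n * 1" by (simp add: algebra_simps)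
        finally show "x \<bullet> q \<le> 1" using n mult_le_cancel_left_pos by blast
      qed
    qed
  qed
qed

section \<open>The general case by translating the polar\<close>

theorem theorem3:
  fixes Q :: "(real ^ 'n) set"
  assumes "polytope Q"
    and "cball 0 1 \<subseteq> Q"
  shows "\<exists>V. V \<subseteq> {v. v extreme_point_of Q} \<and> finite V \<and> card V \<le> 2 * CARD('n) \<and>
    (\<lambda>x. (1 / (5 * (real CARD('n))\<^sup>2)) *\<^sub>R x) ` cball 0 1 \<subseteq> convex hull V"
proof -
  let ?d = "real CARD('n)"
  have d: "?d \<ge> 1" by (simp add: Suc_leI)
  define V where "V = {v. v extreme_point_of Q}"
  obtain F where F: "finite F" "Q = convex hull F" using assms(1) unfolding polytope_def by blast
  have finV: "finite V"
    unfolding V_def F(2) using extreme_points_of_convex_hull F(1) finite_subset by blast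
  have QV: "Q = convex hull V"
    unfolding V_def F(2) using Krein_Milman_polytope[OF F(1)] .
  have ballV: "cball 0 1 \<subseteq> convex hull V" using assms(2) QV by simp
  define P where "P = {x. \<forall>v\<in>V. v \<bullet> x \<le> 1}"
  have P_norm: "norm x \<le> 1" if "x \<in> P" for x
    using norm_le_if_cball_subset_hull[OF ballV, of x] that by (simp add: P_def inner_commute)
  have P_Int: "P = (\<Inter>v\<in>V. {x. v \<bullet> x \<le> 1})" unfolding P_def by auto
  have "closed P" unfolding P_Int by (intro closed_INT) (simp add: closed_halfspace_le)
  moreover have "bounded P" using P_norm by (auto intro: boundedI)
  ultimately have "compact P" by (simp add: compact_eq_bounded_closed)
  moreover have "convex P" unfolding P_Int by (intro convex_INT) (simp add: convex_halfspace_le)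
  moreover have "0 \<in> P" unfolding P_def by simp
  ultimately obtain z where z: "z \<in> P" "\<And>x. x \<in> P \<Longrightarrow> z + (z - x) /\<^sub>R ?d \<in> P"
    using exists_centre_asymmetry_le_dim[of P] by auto
  \<comment> \<open>That the point opposite to \<open>0\<close> lies in \<open>P\<close> keeps \<open>z\<close> away from the unit sphere, and so makes each \<open>\<mu> v\<close> positive.\<close>
  have "z + (z - 0) /\<^sub>R ?d \<in> P" using z(2) \<open>0 \<in> P\<close> by blast
  moreover have "z + (z - 0) /\<^sub>R ?d = ((?d + 1) / ?d) *\<^sub>R z"
    using d by (simp add: add_divide_distrib scaleR_add_left inverse_eq_divide)
  ultimately have zP: "((?d + 1) / ?d) *\<^sub>R z \<in> P" by simp
  have z_norm: "norm z \<le> ?d / (?d + 1)" using P_norm[OF zP] d by (simp add: field_simps)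
  define \<mu> where "\<mu> v = 1 - v \<bullet> z" for v
  have \<mu>: "\<mu> v > 0" if "v \<in> V" for v
  proof -
    have "(?d + 1) / ?d * (v \<bullet> z) \<le> 1" using zP that unfolding P_def by auto
    then have "v \<bullet> z \<le> ?d / (?d + 1)" using d by (simp add: field_simps)
    also have "\<dots> < 1" using d by simp
    finally show ?thesis unfolding \<mu>_def by simp
  qed
  define w where "w v = inverse (\<mu> v) *\<^sub>R v" for v
  have w_inner: "x \<bullet> w v \<le> 1 \<longleftrightarrow> v \<bullet> (z + x) \<le> 1" if "v \<in> V" for x v
    using \<mu>[OF that] unfolding w_def
    by (simp add: field_simps inner_add_right inner_commute) (simp add: \<mu>_def inner_commute algebra_simps)
  have zero: "0 \<in> convex hull V" using ballV by auto
  have zeroW: "0 \<in> convex hull (w ` V)"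
    unfolding w_def by (rule zero_in_convex_hull_rescale) (use finV zero \<mu> in auto)
  have polarW: "z + x \<in> P" if "\<And>u. u \<in> w ` V \<Longrightarrow> x \<bullet> u \<le> 1" for x
    using that w_inner unfolding P_def by auto
  define r where "r = (?d + 1) / (2 * ?d + 1)"
  have "r > 0" unfolding r_def using d by simp
  have ballW: "cball 0 r \<subseteq> convex hull (w ` V)"
  proof
    fix q :: "real^'n" assume q: "q \<in> cball 0 r"
    show "q \<in> convex hull (w ` V)"
    proof (rule convex_hull_bipolar[OF _ zeroW])
      fix x assume "\<And>u. u \<in> w ` V \<Longrightarrow> x \<bullet> u \<le> 1"
      then have "norm (z + x) \<le> 1" by (intro P_norm polarW)
      then have "norm x \<le> 1 + ?d / (?d + 1)"
        using z_norm norm_triangle_ineq4[of "z + x" z] by simp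
      also have "\<dots> = 1 / r" unfolding r_def using d by (simp add: field_simps)
      finally have "norm x * norm q \<le> 1 / r * r"
        using q \<open>r > 0\<close> by (intro mult_mono) auto
      then show "x \<bullet> q \<le> 1" using norm_cauchy_schwarz[of x q] \<open>r > 0\<close> by simp
    qed (use finV in simp)
  qed
  have asymW: "- (u /\<^sub>R ?d) \<in> convex hull (w ` V)" if u: "u \<in> w ` V" for u
  proof (rule convex_hull_bipolar[OF _ zeroW])
    obtain v where v: "v \<in> V" "u = w v" using u by blast
    fix x assume "\<And>u. u \<in> w ` V \<Longrightarrow> x \<bullet> u \<le> 1"
    then have "z + (z - (z + x)) /\<^sub>R ?d \<in> P" by (intro z(2) polarW)
    then have "v \<bullet> (z + - (x /\<^sub>R ?d)) \<le> 1" using v(1) unfolding P_def by simp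
    then have "- (x /\<^sub>R ?d) \<bullet> w v \<le> 1" using w_inner[OF v(1)] by blast
    then show "x \<bullet> - (u /\<^sub>R ?d) \<le> 1" using v(2) by simp
  qed (use finV in simp)
  obtain I where I: "I \<subseteq> w ` V" "card I \<le> 2 * CARD('n)"
    "cball 0 (r / (?d * (?d + 2))) \<subseteq> convex hull I"
    by (rule steinitz_bounded_asymmetry[OF finite_imageI[OF finV] \<open>r > 0\<close> ballW asymW])
  obtain V' where V': "V' \<subseteq> V" "inj_on w V'" "I = w ` V'"
    using I(1) by (auto simp: subset_image_inj)
  have finV': "finite V'" using V'(1) finV finite_subset by blast
  \<comment> \<open>The factors \<open>\<mu>\<close> undo the rescaling by \<open>w\<close>.\<close>
  have zeroV': "0 \<in> convex hull V'"
  proof -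
    have "0 \<in> convex hull (w ` V')"
      using I(3) \<open>r > 0\<close> d unfolding V'(3) by (auto simp: subset_iff)
    then have "0 \<in> convex hull ((\<lambda>v. \<mu> v *\<^sub>R w v) ` V')"
      by (rule zero_in_convex_hull_rescale[OF finV']) (use \<mu> V'(1) in auto)
    moreover have "(\<lambda>v. \<mu> v *\<^sub>R w v) ` V' = (\<lambda>v. v) ` V'"
      by (rule image_cong) (use \<mu> V'(1) in \<open>force simp: w_def\<close>)+
    ultimately show ?thesis by simp
  qed
  have "(1 / (5 * ?d\<^sup>2)) *\<^sub>R p \<in> convex hull V'" if p: "p \<in> cball 0 1" for p
  proof (rule convex_hull_bipolar[OF finV' zeroV'])
    fix x assume x: "\<And>v. v \<in> V' \<Longrightarrow> x \<bullet> v \<le> 1"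
    have dd: "?d * (?d + 2) > 0" using d by simp
    have "r / (?d * (?d + 2)) * norm (x - z) \<le> 1"
    proof (rule norm_le_if_cball_subset_hull[OF I(3)])
      fix u assume "u \<in> I"
      then obtain v where v: "v \<in> V'" "u = w v" using V'(3) by blast
      then show "(x - z) \<bullet> u \<le> 1"
        using x[OF v(1)] w_inner[of v "x - z"] V'(1) by (auto simp: inner_commute)
    qed (use \<open>r > 0\<close> in simp)
    then have "norm (x - z) \<le> ?d * (?d + 2) / r"
      using \<open>r > 0\<close> d dd by (simp add: divide_le_eq le_divide_eq mult.commute)
    then have "norm x \<le> ?d * (?d + 2) / r + ?d / (?d + 1)"
      using z_norm norm_triangle_ineq[of "x - z" z] unfolding diff_add_cancel by linarith
    also have "\<dots> = (?d * (?d + 2) * (2 * ?d + 1) + ?d) / (?d + 1)"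
      unfolding r_def by (simp flip: add_divide_distrib)
    also have "\<dots> \<le> 5 * ?d\<^sup>2"
    proof -
      have "?d * 1 \<le> ?d * ?d\<^sup>2" using d by (intro mult_left_mono) auto
      then have "?d * (?d + 2) * (2 * ?d + 1) + ?d \<le> 5 * ?d\<^sup>2 * (?d + 1)"
        by (simp add: algebra_simps power2_eq_square)
      then show ?thesis using d by (simp add: divide_le_eq)
    qed
    finally have "norm x * norm p \<le> 5 * ?d\<^sup>2 * 1" using p by (intro mult_mono) auto
    then have "x \<bullet> p \<le> 5 * ?d\<^sup>2" using norm_cauchy_schwarz[of x p] by simp
    then show "x \<bullet> ((1 / (5 * ?d\<^sup>2)) *\<^sub>R p) \<le> 1" using d by (simp add: field_simps)
  qed
  moreover have "card V' \<le> 2 * CARD('n)"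
    using I(2) V' by (simp add: card_image)
  ultimately show ?thesis
    using V'(1) finV' unfolding V_def by (intro exI[of _ V']) blast
qed

end
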